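(* Let $n\ge3$ and consider the staircase system $$\dot x_i=f_i(x_1,\dots,x_{i+2}),\ i=1,\dots,n-2,\qquad \dot x_{n-1}=f_{n-1}(x_1,\dots,x_n,u),\qquad \dot x_n=f_n(x_1,\dots,x_n,u),$$ with $x\in\mathbb R^n$, $u\in\mathbb R$, where $f_1,\dots,f_{n-2}$ are $n$ times continuously differentiable and $f_{n-1},f_n$ are continuously differentiable. Suppose there is a constant $a_*>0$ such that $$\left|\frac{\partial f_i(x_1,\dots,x_{i+2})}{\partial x_{i+2}}\right|\ge a_*\quad\text{for all } x\in\mathbb R^n,\ i=1,\dots,n-2.$$ Let $p$ be the integer with $n=2p$ or $n=2p-1$, put $q=p$ if $n=2p$ and $q=p-1$ if $n=2p-1$, let $a(x)=(f_1,\dots,f_{n-2},0,0)^*$, and define $$y_k=L_a^{k-1}x_1,\ k=1,\dots,p,\qquad z_k=L_a^{k-1}x_2,\ k=1,\dots,q.$$ Then $y_k$ depends only on $x_1,\dots,x_{2k-1}$ and $z_k$ depends only on $x_1,\dots,x_{2k}$; the change of variables $x\mapsto(y_1,\dots,y_p,z_1,\dots,z_q)$ is nonsingular (its Jacobian determinant does not vanish on $\mathbb R^n$) and is uniquely solvable with respect to $x_1,\dots,x_n$ for every $(y,z)\in\mathbb R^{n}$; and it maps the staircase system to a system of the form $$\dot y_i=y_{i+1},\ i=1,\dots,p-1,\quad \dot y_p=H_1(y_1,\dots,y_p,z_1,\dots,z_q,u),$$ $$\dot z_i=z_{i+1},\ i=1,\dots,q-1,\quad \dot z_q=H_2(y_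1,\dots,y_p,z_1,\dots,z_q,u).$$
   Context: For a scalar function $\varphi$ and vector field $a$, $L_a\varphi(x)=\varphi_x(x)a(x)$ where $\varphi_x$ is the row gradient; $L_a^0\varphi=\varphi$, $L_a^k\varphi=L_a(L_a^{k-1}\varphi)$. $^*$ denotes transposition. Here $L_a^{k-1}x_1$ and $L_a^{k-1}x_2$ denote iterated derivatives along $a$ of the coordinate functions $x\mapsto x_1$ and $x\mapsto x_2$. *)

theory Defs
  imports "HOL-Analysis.Analysis"
begin

text \<open>
  Coordinates of \<open>real ^ 'n\<close> are numbered 1, ..., n by a labelling \<open>ix\<close> with
  \<open>bij_betw ix {1..CARD('n)} UNIV\<close>, so that \<open>x $ ix i\<close> is the i-th coordinate of \<open>x\<close>.
\<close>

definition from_coords :: "(nat \<Rightarrow> 'n::finite) \<Rightarrow> (nat \<Rightarrow> real) \<Rightarrow> real ^ 'n" where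
  "from_coords ix c = (\<Sum>i\<in>{1..CARD('n)}. c i *\<^sub>R axis (ix i) 1)"

lemma from_coords_nth:
  fixes ix :: "nat \<Rightarrow> 'n::finite"
  assumes "bij_betw ix {1..CARD('n)} UNIV" and "i \<in> {1..CARD('n)}"
  shows "from_coords ix c $ ix i = c i"
proof -
  have inj: "inj_on ix {1..CARD('n)}" using assms(1) by (rule bij_betw_imp_inj_on)
  have "from_coords ix c $ ix i = (\<Sum>k\<in>{1..CARD('n)}. if k = i then c k else 0)"
    unfolding from_coords_def sum_component
  proof (rule sum.cong)
    fix k assume "k \<in> {1..CARD('n)}"
    then have "ix k = ix i \<longleftrightarrow> k = i" using inj_on_eq_iff[OF inj] assms(2) by blast
    then show "(c k *\<^sub>R axis (ix k) 1) $ ix i = (if k = i then c k else 0)"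
      by (cases "k = i") (auto simp: axis_def)
  qed (rule refl)
  also have "\<dots> = c i" using assms(2) by simp
  finally show ?thesis .
qed

definition depends_only_on_first ::
  "(nat \<Rightarrow> 'n::finite) \<Rightarrow> nat \<Rightarrow> (real ^ 'n \<Rightarrow> real) \<Rightarrow> bool" where
  "depends_only_on_first ix m \<phi> \<longleftrightarrow>
     (\<forall>x x'. (\<forall>j\<in>{1..m}. x $ ix j = x' $ ix j) \<longrightarrow> \<phi> x = \<phi> x')"

primrec times_cont_diff :: "nat \<Rightarrow> ('a::euclidean_space \<Rightarrow> real) \<Rightarrow> bool" where
  "times_cont_diff 0 \<phi> \<longleftrightarrow> continuous_on UNIV \<phi>"
| "times_cont_diff (Suc k) \<phi> \<longleftrightarrow>
     (\<forall>x. \<phi> differentiable (at x)) \<and>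
     (\<forall>v. times_cont_diff k (\<lambda>x. frechet_derivative \<phi> (at x) v))"

definition partial_deriv :: "'n::finite \<Rightarrow> (real ^ 'n \<Rightarrow> real) \<Rightarrow> real ^ 'n \<Rightarrow> real" where
  "partial_deriv j \<phi> x = frechet_derivative \<phi> (at x) (axis j 1)"

definition lie_deriv ::
  "(real ^ 'n \<Rightarrow> real ^ 'n) \<Rightarrow> (real ^ 'n \<Rightarrow> real) \<Rightarrow> real ^ 'n \<Rightarrow> real" where
  "lie_deriv a \<phi> = (\<lambda>x. frechet_derivative \<phi> (at x) (a x))"

text \<open>
  Staircase system: \<open>f i\<close> is the right-hand side for i = 1, ..., n - 2, while \<open>g\<close> and \<open>h\<close>
  are those of the equations n - 1 and n, in which the control \<open>u\<close> enters.
\<close>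

definition staircase_field ::
  "(nat \<Rightarrow> 'n::finite) \<Rightarrow> (nat \<Rightarrow> real ^ 'n \<Rightarrow> real) \<Rightarrow> (real ^ 'n \<Rightarrow> real \<Rightarrow> real) \<Rightarrow>
   (real ^ 'n \<Rightarrow> real \<Rightarrow> real) \<Rightarrow> real ^ 'n \<Rightarrow> real \<Rightarrow> real ^ 'n" where
  "staircase_field ix f g h x u =
     from_coords ix (\<lambda>i. if i \<le> CARD('n) - 2 then f i x
                          else if i = CARD('n) - 1 then g x u else h x u)"

definition drift_field ::
  "(nat \<Rightarrow> 'n::finite) \<Rightarrow> (nat \<Rightarrow> real ^ 'n \<Rightarrow> real) \<Rightarrow> real ^ 'n \<Rightarrow> real ^ 'n" where
  "drift_field ix f x = from_coords ix (\<lambda>i. if i \<le> CARD('n) - 2 then f i x else 0)"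

definition y_var ::
  "(nat \<Rightarrow> 'n::finite) \<Rightarrow> (nat \<Rightarrow> real ^ 'n \<Rightarrow> real) \<Rightarrow> nat \<Rightarrow> real ^ 'n \<Rightarrow> real" where
  "y_var ix f k = (lie_deriv (drift_field ix f) ^^ (k - 1)) (\<lambda>x. x $ ix 1)"

definition z_var ::
  "(nat \<Rightarrow> 'n::finite) \<Rightarrow> (nat \<Rightarrow> real ^ 'n \<Rightarrow> real) \<Rightarrow> nat \<Rightarrow> real ^ 'n \<Rightarrow> real" where
  "z_var ix f k = (lie_deriv (drift_field ix f) ^^ (k - 1)) (\<lambda>x. x $ ix 2)"

text \<open>
  A point (y, z) with p + q = n is the vector whose coordinates 1, ..., p are the y's and
  whose coordinates p + 1, ..., p + q are the z's.
\<close>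

definition new_coords ::
  "(nat \<Rightarrow> 'n::finite) \<Rightarrow> (nat \<Rightarrow> real ^ 'n \<Rightarrow> real) \<Rightarrow> nat \<Rightarrow> real ^ 'n \<Rightarrow> real ^ 'n" where
  "new_coords ix f p x =
     from_coords ix (\<lambda>k. if k \<le> p then y_var ix f k x else z_var ix f (k - p) x)"

definition two_chain_field ::
  "(nat \<Rightarrow> 'n::finite) \<Rightarrow> nat \<Rightarrow> nat \<Rightarrow> (real ^ 'n \<Rightarrow> real \<Rightarrow> real) \<Rightarrow>
   (real ^ 'n \<Rightarrow> real \<Rightarrow> real) \<Rightarrow> real ^ 'n \<Rightarrow> real \<Rightarrow> real ^ 'n" where
  "two_chain_field ix p q H1 H2 w u =
     from_coords ix (\<lambda>k. if k = p then H1 w u else if k = p + q then H2 w u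
                          else w $ ix (k + 1))"

definition is_trajectory ::
  "(real ^ 'n \<Rightarrow> real \<Rightarrow> real ^ 'n) \<Rightarrow> real set \<Rightarrow> (real \<Rightarrow> real) \<Rightarrow> (real \<Rightarrow> real ^ 'n) \<Rightarrow> bool"
  where
  "is_trajectory F I u x \<longleftrightarrow>
     (\<forall>t\<in>I. (x has_vector_derivative F (x t) (u t)) (at t within I))"

text \<open>
  A change of variables maps one control system to another if differentiating the new
  variables along the first system gives the right-hand side of the second one. We demand
  this pointwise and, equivalently for a smooth change of variables, for trajectories.
\<close>

definition maps_system ::
  "(real ^ 'n::finite \<Rightarrow> real ^ 'n) \<Rightarrow> (real ^ 'n \<Rightarrow> real \<Rightarrow> real ^ 'n) \<Rightarrow>
   (real ^ 'n \<Rightarrow> real \<Rightarrow> real ^ 'n) \<Rightarrow> bool" where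
  "maps_system \<Phi> F G \<longleftrightarrow>
     (\<forall>x u. frechet_derivative \<Phi> (at x) (F x u) = G (\<Phi> x) u) \<and>
     (\<forall>I u x. is_interval I \<longrightarrow>
        (is_trajectory F I u x \<longleftrightarrow> is_trajectory G I u (\<Phi> \<circ> x)))"

end

theory Submission
  imports Defs
begin

text \<open>
  Interleave the new variables as \<open>w\<^sub>1 = y\<^sub>1, w\<^sub>2 = z\<^sub>1, w\<^sub>3 = y\<^sub>2, w\<^sub>4 = z\<^sub>2, \<dots>\<close>, so that
  \<open>w\<^sub>m\<^sub>+\<^sub>2 = L\<^sub>a w\<^sub>m\<close>. Since \<open>w\<^sub>m\<close> depends on \<open>x\<^sub>1, \<dots>, x\<^sub>m\<close> only and the only \<open>a\<^sub>i\<close> with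
  \<open>i \<le> m\<close> involving \<open>x\<^sub>m\<^sub>+\<^sub>2\<close> is \<open>f\<^sub>m\<close>, the partial derivative of \<open>w\<^sub>m\<^sub>+\<^sub>2\<close> in \<open>x\<^sub>m\<^sub>+\<^sub>2\<close> is
  \<open>\<partial>w\<^sub>m/\<partial>x\<^sub>m \<cdot> \<partial>f\<^sub>m/\<partial>x\<^sub>m\<^sub>+\<^sub>2\<close>, hence bounded away from 0. The map \<open>x \<mapsto> w\<close> is thus triangular
  with diagonal entries bounded away from 0, and can be inverted one coordinate at a time.
\<close>

subsection \<open>Continuously differentiable functions\<close>

lemma times_cont_diff_const: "times_cont_diff k (\<lambda>x. c)"
  by (induction k arbitrary: c) auto

lemma times_cont_diff_linear:
  assumes "bounded_linear \<phi>"
  shows "times_cont_diff k \<phi>"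
proof (cases k)
  case 0
  then show ?thesis using assms by (simp add: linear_continuous_on)
next
  case (Suc l)
  have "(\<phi> has_derivative \<phi>) (at x)" for x
    using assms by (rule bounded_linear_imp_has_derivative)
  then have "\<phi> differentiable (at x)" "frechet_derivative \<phi> (at x) = \<phi>" for x
    by (auto simp: differentiable_def frechet_derivative_at[symmetric])
  then show ?thesis by (simp add: Suc times_cont_diff_const)
qed

lemma times_cont_diff_SucD: "times_cont_diff (Suc k) \<phi> \<Longrightarrow> times_cont_diff k \<phi>"
proof (induction k arbitrary: \<phi>)
  case 0
  then have "\<phi> differentiable_on UNIV" by (simp add: differentiable_on_def)
  then show ?case by (simp add: differentiable_imp_continuous_on)
next
  case (Suc k)
  from Suc.prems have "\<forall>x. \<phi> differentiable (at x)"
    "times_cont_diff (Suc k) (\<lambda>x. frechet_derivative \<phi> (at x) v)" for v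
    by simp_all
  then show ?case using Suc.IH by simp
qed

lemma times_cont_diff_mono:
  assumes "times_cont_diff k \<phi>" "j \<le> k"
  shows "times_cont_diff j \<phi>"
  using assms(2,1) by (induction rule: dec_induct) (use times_cont_diff_SucD in blast)+

lemma times_cont_diff_add:
  "times_cont_diff k \<phi> \<Longrightarrow> times_cont_diff k \<psi> \<Longrightarrow> times_cont_diff k (\<lambda>x. \<phi> x + \<psi> x)"
proof (induction k arbitrary: \<phi> \<psi>)
  case 0
  then show ?case by (simp add: continuous_on_add)
next
  case (Suc k)
  then have d: "\<phi> differentiable (at x)" "\<psi> differentiable (at x)" for x by auto
  have "frechet_derivative (\<lambda>x. \<phi> x + \<psi> x) (at x) =
      (\<lambda>v. frechet_derivative \<phi> (at x) v + frechet_derivative \<psi> (at x) v)" for x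
    by (rule frechet_derivative_at[symmetric], rule has_derivative_add)
      (use d in \<open>auto simp: frechet_derivative_works[symmetric]\<close>)
  with Suc d show ?case by simp
qed

lemma times_cont_diff_mult:
  "times_cont_diff k \<phi> \<Longrightarrow> times_cont_diff k \<psi> \<Longrightarrow> times_cont_diff k (\<lambda>x. \<phi> x * \<psi> x)"
proof (induction k arbitrary: \<phi> \<psi>)
  case 0
  then show ?case by (simp add: continuous_on_mult)
next
  case (Suc k)
  then have d: "\<phi> differentiable (at x)" "\<psi> differentiable (at x)" for x by auto
  have "frechet_derivative (\<lambda>x. \<phi> x * \<psi> x) (at x) =
      (\<lambda>v. \<phi> x * frechet_derivative \<psi> (at x) v + frechet_derivative \<phi> (at x) v * \<psi> x)" for x
    by (rule frechet_derivative_at[symmetric], rule has_derivative_mult)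
      (use d in \<open>auto simp: frechet_derivative_works[symmetric]\<close>)
  \<comment> \<open>The product rule leaves one factor undifferentiated in each summand; that factor
    is used with order \<open>k\<close> instead of \<open>Suc k\<close>.\<close>
  with Suc d times_cont_diff_SucD[OF Suc.prems(1)] times_cont_diff_SucD[OF Suc.prems(2)]
  show ?case by (simp add: times_cont_diff_add)
qed

lemma times_cont_diff_sum:
  "finite A \<Longrightarrow> (\<And>i. i \<in> A \<Longrightarrow> times_cont_diff k (\<phi> i)) \<Longrightarrow>
   times_cont_diff k (\<lambda>x. \<Sum>i\<in>A. \<phi> i x)"
  by (induction A rule: finite_induct) (auto simp: times_cont_diff_const times_cont_diff_add)

subsection \<open>Functions of the first coordinates\<close>

text \<open>Reduces directional derivatives to one-variable calculus, where the mean value theorem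
  and uniqueness of derivatives apply.\<close>

lemma frechet_derivative_line:
  fixes \<phi> :: "'a::real_normed_vector \<Rightarrow> real"
  assumes "\<phi> differentiable (at (x + s *\<^sub>R v))"
  shows "((\<lambda>s. \<phi> (x + s *\<^sub>R v)) has_real_derivative frechet_derivative \<phi> (at (x + s *\<^sub>R v)) v) (at s)"
proof -
  have "((\<lambda>s. x + s *\<^sub>R v) has_derivative (\<lambda>h. h *\<^sub>R v)) (at s)"
    by (auto intro!: derivative_eq_intros)
  moreover have "(\<phi> has_derivative frechet_derivative \<phi> (at (x + s *\<^sub>R v))) (at (x + s *\<^sub>R v))"
    using assms by (simp add: frechet_derivative_works[symmetric])
  ultimately have "((\<lambda>s. \<phi> (x + s *\<^sub>R v)) has_derivative
      (\<lambda>h. frechet_derivative \<phi> (at (x + s *\<^sub>R v)) (h *\<^sub>R v))) (at s)"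
    by (rule has_derivative_compose)
  then show ?thesis
    using linear_scale[OF linear_frechet_derivative[OF assms]]
    by (simp add: has_field_derivative_def mult_commute_abs)
qed

lemma frechet_derivative_line_0:
  fixes \<phi> :: "'a::real_normed_vector \<Rightarrow> real"
  assumes "\<phi> differentiable (at x)"
  shows "((\<lambda>s. \<phi> (x + s *\<^sub>R v)) has_real_derivative frechet_derivative \<phi> (at x) v) (at 0)"
  using frechet_derivative_line[of \<phi> x 0 v] assms by simp

lemma depends_only_on_firstD:
  assumes "depends_only_on_first ix m \<phi>" "\<And>j. j \<in> {1..m} \<Longrightarrow> x $ ix j = x' $ ix j"
  shows "\<phi> x = \<phi> x'"
  using assms by (auto simp: depends_only_on_first_def)

text \<open>The restrictions of \<open>\<phi>\<close> to the lines \<open>x + s *\<^sub>R v\<close>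
  and \<open>x' + s *\<^sub>R v'\<close> coincide, hence so do their derivatives at 0. Base point
  and direction may thus both be replaced beyond coordinate \<open>m\<close>.\<close>

lemma frechet_derivative_depends_only:
  assumes dep: "depends_only_on_first ix m \<phi>"
    and d: "\<phi> differentiable (at x)" "\<phi> differentiable (at x')"
    and x: "\<And>j. j \<in> {1..m} \<Longrightarrow> x $ ix j = x' $ ix j"
    and v: "\<And>j. j \<in> {1..m} \<Longrightarrow> v $ ix j = v' $ ix j"
  shows "frechet_derivative \<phi> (at x) v = frechet_derivative \<phi> (at x') v'"
proof -
  have "\<phi> (x + s *\<^sub>R v) = \<phi> (x' + s *\<^sub>R v')" for s
    by (rule depends_only_on_firstD[OF dep]) (simp add: x v)
  then show ?thesis
    using frechet_derivative_line_0[OF d(1), of v] frechet_derivative_line_0[OF d(2), of v']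
    by (simp add: DERIV_unique)
qed

subsection \<open>Real functions with derivative bounded away from zero\<close>

lemma inj_if_deriv_nonzero:
  fixes \<phi> \<phi>' :: "real \<Rightarrow> real"
  assumes d: "\<And>s. (\<phi> has_real_derivative \<phi>' s) (at s)" and nz: "\<And>s. \<phi>' s \<noteq> 0"
  shows "inj \<phi>"
proof (rule linorder_injI)
  fix s t :: real assume "s < t"
  then obtain \<xi> where "\<phi> t - \<phi> s = (t - s) * \<phi>' \<xi>" using MVT2[of s t \<phi> \<phi>'] d by blast
  with nz[of \<xi>] \<open>s < t\<close> show "\<phi> s \<noteq> \<phi> t" by auto
qed

text \<open>A nonvanishing derivative gives injectivity; the uniform bound \<open>c\<close> makes
  the range unbounded in both directions, so the intermediate value theorem gives
  surjectivity.\<close>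

lemma bij_if_deriv_bounded_below:
  fixes \<phi> \<phi>' :: "real \<Rightarrow> real"
  assumes d: "\<And>s. (\<phi> has_real_derivative \<phi>' s) (at s)"
    and c: "c > 0" "\<And>s. \<bar>\<phi>' s\<bar> \<ge> c"
  shows "bij \<phi>"
proof -
  have inj: "inj \<phi>" 
  proof (rule inj_if_deriv_nonzero[OF d])
    show "\<phi>' s \<noteq> 0" for s using c(1) c(2)[of s] by auto
  qed
  have cont: "continuous_on A \<phi>" for A
    using d by (meson DERIV_continuous_on has_field_derivative_at_within)
  have "\<exists>s. \<phi> s = t" for t
  proof -
    \<comment> \<open>Over an interval of length \<open>r\<close> the function moves by at least
      \<open>r * c\<close>, which exceeds the distance from \<open>\<phi> 0\<close> to the target
      \<open>t\<close> by 1.\<close>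
    define r where "r = (\<bar>t - \<phi> 0\<bar> + 1) / c"
    have r: "r > 0" using c by (simp add: r_def)
    have grow: "\<bar>\<phi> b - \<phi> a\<bar> > \<bar>t - \<phi> 0\<bar>" if ab: "b - a = r" for a b
    proof -
      obtain \<xi> where "\<phi> b - \<phi> a = r * \<phi>' \<xi>"
        using MVT2[of a b \<phi> \<phi>'] d r ab by force
      then have "\<bar>\<phi> b - \<phi> a\<bar> = r * \<bar>\<phi>' \<xi>\<bar>" using r by (simp add: abs_mult)
      also have "\<dots> \<ge> r * c" using c r by simp
      also have "r * c = \<bar>t - \<phi> 0\<bar> + 1" using c by (simp add: r_def)
      finally show ?thesis by linarith
    qed
    \<comment> \<open>Continuity and injectivity force monotonicity, so the moves to
      \<open>-r\<close> and to \<open>r\<close> go in opposite directions and enclose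
      \<open>t\<close>.\<close>
    have "(\<phi> (-r) < \<phi> 0 \<and> \<phi> 0 < \<phi> r) \<or> (\<phi> r < \<phi> 0 \<and> \<phi> 0 < \<phi> (-r))"
      using r inj by (intro continuous_inj_imp_mono cont) (auto intro: inj_on_subset)
    then have "(\<phi> (-r) \<le> t \<and> t \<le> \<phi> r) \<or> (\<phi> r \<le> t \<and> t \<le> \<phi> (-r))"
      using grow[of 0 "-r"] grow[of r 0] by linarith
    then show ?thesis
      using IVT'[of \<phi> "-r" t r] IVT2'[of \<phi> r t "-r"] r cont[of "{-r..r}"] by auto
  qed
  then have "surj \<phi>" by (metis surj_def)
  with inj show ?thesis by (rule bijI)
qed

subsection \<open>Triangular maps\<close>

locale coordinate_labelling =
  fixes ix :: "nat \<Rightarrow> 'n::finite"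
  assumes ix: "bij_betw ix {1..CARD('n)} UNIV"
begin

lemma ix_eq_iff: "i \<in> {1..CARD('n)} \<Longrightarrow> j \<in> {1..CARD('n)} \<Longrightarrow> ix i = ix j \<longleftrightarrow> i = j"
  using ix by (meson bij_betw_imp_inj_on inj_on_eq_iff)

lemma vec_eqI: "(\<And>m. m \<in> {1..CARD('n)} \<Longrightarrow> x $ ix m = y $ ix m) \<Longrightarrow> x = y"
  using ix by (metis bij_betw_imp_surj_on imageE UNIV_I vec_eq_iff)

lemma axis_nth: "i \<in> {1..CARD('n)} \<Longrightarrow> j \<in> {1..CARD('n)} \<Longrightarrow>
    (axis (ix i) 1 :: real ^ 'n) $ ix j = (if j = i then 1 else 0)"
  using ix_eq_iff by (auto simp: axis_def)

end

locale triangular_map = coordinate_labelling ix for ix :: "nat \<Rightarrow> 'n::finite" +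
  fixes \<phi> :: "nat \<Rightarrow> real ^ 'n \<Rightarrow> real" and c :: "nat \<Rightarrow> real"
  assumes dep: "\<And>m. m \<in> {1..CARD('n)} \<Longrightarrow> depends_only_on_first ix m (\<phi> m)"
    and diff: "\<And>m x. m \<in> {1..CARD('n)} \<Longrightarrow> \<phi> m differentiable (at x)"
    and c_pos: "\<And>m. m \<in> {1..CARD('n)} \<Longrightarrow> c m > 0"
    and diag: "\<And>m x. m \<in> {1..CARD('n)} \<Longrightarrow> \<bar>partial_deriv (ix m) (\<phi> m) x\<bar> \<ge> c m"
begin

text \<open>Forward substitution: once the coordinates of \<open>v\<close> before \<open>m\<close>
  vanish, \<open>v\<close> acts on \<open>\<phi> m\<close> like a multiple of the
  \<open>m\<close>-th axis, so the equation reads coordinate times nonzero diagonal entry equals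
  0.\<close>

lemma kernel_trivial:
  assumes 0: "\<And>m. m \<in> {1..CARD('n)} \<Longrightarrow> frechet_derivative (\<phi> m) (at x) v = 0"
  shows "v = 0"
proof -
  have "v $ ix m = 0" if "m \<in> {1..CARD('n)}" for m
    using that
  proof (induction m rule: less_induct)
    case (less m)
    have "frechet_derivative (\<phi> m) (at x) v =
        frechet_derivative (\<phi> m) (at x) (v $ ix m *\<^sub>R axis (ix m) 1)"
    proof (rule frechet_derivative_depends_only[OF dep[OF less.prems] diff diff])
      fix j assume j: "j \<in> {1..m}"
      then show "v $ ix j = (v $ ix m *\<^sub>R axis (ix m) 1) $ ix j"
        using less.IH[of j] less.prems axis_nth[of m j] by (cases "j = m") auto
    qed (use less.prems in auto)
    also have "\<dots> = v $ ix m * partial_deriv (ix m) (\<phi> m) x"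
      using linear_scale[OF linear_frechet_derivative[OF diff[OF less.prems]]]
      by (simp add: partial_deriv_def)
    finally show ?case
      using 0 less.prems c_pos[OF less.prems] diag[OF less.prems, of x] by force
  qed
  then show ?thesis by (intro vec_eqI) simp
qed

lemma bij_coordinate:
  assumes m: "m \<in> {1..CARD('n)}"
  shows "bij (\<lambda>s. \<phi> m (x + s *\<^sub>R axis (ix m) 1))"
  using frechet_derivative_line[OF diff[OF m]] c_pos[OF m] diag[OF m, unfolded partial_deriv_def]
  by (rule bij_if_deriv_bounded_below)

text \<open>If the first \<open>m - 1\<close> coordinates agree, shifting \<open>x\<close> along
  axis \<open>m\<close> by the difference \<open>s\<close> of the \<open>m\<close>-th ones gives
  \<open>\<phi> m\<close> the same value as at \<open>x'\<close>, hence as at \<open>x\<close>.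
  Injectivity along that line yields \<open>s = 0\<close>.\<close>

lemma components_eq_imp_eq:
  assumes eq: "\<And>m. m \<in> {1..CARD('n)} \<Longrightarrow> \<phi> m x = \<phi> m x'"
  shows "x = x'"
proof -
  have "x $ ix m = x' $ ix m" if "m \<in> {1..CARD('n)}" for m
    using that
  proof (induction m rule: less_induct)
    case (less m)
    define s where "s = x' $ ix m - x $ ix m"
    have "\<phi> m (x + s *\<^sub>R axis (ix m) 1) = \<phi> m x'"
    proof (rule depends_only_on_firstD[OF dep[OF less.prems]])
      fix j assume "j \<in> {1..m}"
      then show "(x + s *\<^sub>R axis (ix m) 1) $ ix j = x' $ ix j"
        using less.IH[of j] less.prems axis_nth[of m j] by (cases "j = m") (auto simp: s_def)
    qed
    also have "\<dots> = \<phi> m (x + 0 *\<^sub>R axis (ix m) 1)" using eq less.prems by simp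
    finally have "s = 0"
      using bij_is_inj[OF bij_coordinate[OF less.prems, of x]] by (rule injD[rotated])
    then show ?case by (simp add: s_def)
  qed
  then show ?thesis by (rule vec_eqI)
qed

lemma components_surj: "\<exists>x. \<forall>m\<in>{1..CARD('n)}. \<phi> m x = w m"
proof -
  have "M \<le> CARD('n) \<Longrightarrow> \<exists>x. \<forall>m\<in>{1..M}. \<phi> m x = w m" for M
  proof (induction M)
    case 0
    show ?case by simp
  next
    case (Suc M)
    then have "\<exists>x. \<forall>m\<in>{1..M}. \<phi> m x = w m" by simp
    then obtain x where x: "\<And>m. m \<in> {1..M} \<Longrightarrow> \<phi> m x = w m" by blast
    have M: "Suc M \<in> {1..CARD('n)}" using Suc.prems by simp
    obtain s where s: "w (Suc M) = \<phi> (Suc M) (x + s *\<^sub>R axis (ix (Suc M)) 1)"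
      by (rule surjE[OF bij_is_surj[OF bij_coordinate[OF M]]])
    \<comment> \<open>Adjusting coordinate \<open>Suc M\<close> leaves the equations solved earlier
      intact, since they involve lower coordinates only.\<close>
    have "\<phi> m (x + s *\<^sub>R axis (ix (Suc M)) 1) = \<phi> m x" if m: "m \<in> {1..M}" for m
    proof (rule depends_only_on_firstD[OF dep])
      show "m \<in> {1..CARD('n)}" using m Suc.prems by simp
    next
      fix j assume "j \<in> {1..m}"
      then show "(x + s *\<^sub>R axis (ix (Suc M)) 1) $ ix j = x $ ix j"
        using m M axis_nth[of "Suc M" j] by auto
    qed
    with x s show ?case by (intro exI[of _ "x + s *\<^sub>R axis (ix (Suc M)) 1"])
        (auto simp: le_Suc_eq)
  qed
  then show ?thesis by blast
qed

end

subsection \<open>Changes of variables\<close>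

text \<open>Trajectories go forward by the chain rule for \<open>\<Phi>\<close> and backward by the
  chain rule for \<open>inv \<Phi>\<close>, whose derivative exists because the trivial kernel makes
  the derivative of \<open>\<Phi>\<close> invertible.\<close>

lemma maps_system_pushforward:
  fixes \<Phi> :: "real ^ 'n::finite \<Rightarrow> real ^ 'n"
  assumes diff: "\<And>x. \<Phi> differentiable (at x)"
    and ker: "\<And>x v. frechet_derivative \<Phi> (at x) v = 0 \<Longrightarrow> v = 0"
    and bij: "bij \<Phi>"
    and field: "\<And>x u. frechet_derivative \<Phi> (at x) (F x u) = G (\<Phi> x) u"
  shows "maps_system \<Phi> F G"
proof -
  have der: "(\<Phi> has_derivative frechet_derivative \<Phi> (at x)) (at x within S)" for x S
    using diff by (simp add: frechet_derivative_works[symmetric] has_derivative_at_withinI)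
  have "is_trajectory F I u x \<longleftrightarrow> is_trajectory G I u (\<Phi> \<circ> x)" for I u x
  proof
    assume F: "is_trajectory F I u x"
    show "is_trajectory G I u (\<Phi> \<circ> x)"
      unfolding is_trajectory_def
    proof
      fix t assume "t \<in> I"
      with F have "(x has_vector_derivative F (x t) (u t)) (at t within I)"
        by (simp add: is_trajectory_def)
      from vector_derivative_diff_chain_within[OF this der]
      show "((\<Phi> \<circ> x) has_vector_derivative G ((\<Phi> \<circ> x) t) (u t)) (at t within I)"
        by (simp add: field)
    qed
  next
    assume G: "is_trajectory G I u (\<Phi> \<circ> x)"
    show "is_trajectory F I u x"
      unfolding is_trajectory_def
    proof
      fix t assume t: "t \<in> I"
      let ?D = "frechet_derivative \<Phi> (at (x t))"
      have lin: "linear ?D" using diff by (rule linear_frechet_derivative)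
      moreover have "inj ?D" using lin ker by (simp add: linear_injective_0)
      ultimately obtain D' where D': "linear D'" "\<And>v. D' (?D v) = v" "\<And>v. ?D (D' v) = v"
        using linear_injective_isomorphism by metis
      have "(inv \<Phi> has_derivative D') (at (\<Phi> (x t)))"
      proof (rule has_derivative_inverse_strong[where f = \<Phi> and x = "x t", OF open_UNIV UNIV_I])
        show "continuous_on UNIV \<Phi>"
          using diff by (simp add: differentiable_imp_continuous_on differentiable_on_def)
        show "inv \<Phi> (\<Phi> z) = z" for z using bij by (simp add: bij_is_inj)
        show "(\<Phi> has_derivative ?D) (at (x t))" by (rule der)
        show "?D \<circ> D' = id" using D' by auto
      qed
      then have inv: "(inv \<Phi> has_derivative D') (at ((\<Phi> \<circ> x) t) within (\<Phi> \<circ> x) ` I)"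
        by (simp add: has_derivative_at_withinI)
      \<comment> \<open>The right-hand side given by \<open>G\<close> is rewritten as an image under
        \<open>?D\<close>, so that \<open>D'\<close> cancels it.\<close>
      have "((\<Phi> \<circ> x) has_vector_derivative ?D (F (x t) (u t))) (at t within I)"
        using G t by (simp add: is_trajectory_def field)
      from vector_derivative_diff_chain_within[OF this inv]
      have "((inv \<Phi> \<circ> (\<Phi> \<circ> x)) has_vector_derivative F (x t) (u t)) (at t within I)"
        by (simp only: D')
      moreover have "inv \<Phi> \<circ> (\<Phi> \<circ> x) = x" using bij by (auto simp: bij_is_inj)
      ultimately show "(x has_vector_derivative F (x t) (u t)) (at t within I)" by simp
    qed
  qed
  then show ?thesis by (simp add: maps_system_def field)
qed

lemma det_jacobian_nonzero:
  fixes \<Phi> :: "real ^ 'n::finite \<Rightarrow> real ^ 'n"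
  assumes diff: "\<Phi> differentiable (at x)"
    and ker: "\<And>v. frechet_derivative \<Phi> (at x) v = 0 \<Longrightarrow> v = 0"
  shows "det (jacobian \<Phi> (at x)) \<noteq> 0"
proof -
  have "(\<Phi> has_derivative (\<lambda>v. jacobian \<Phi> (at x) *v v)) (at x)"
    using diff by (simp add: jacobian_works)
  then have "(\<lambda>v. jacobian \<Phi> (at x) *v v) = frechet_derivative \<Phi> (at x)"
    by (rule frechet_derivative_at)
  then have "\<exists>B. B ** jacobian \<Phi> (at x) = mat 1"
    using ker by (auto simp: matrix_left_invertible_ker fun_eq_iff)
  then show ?thesis
    using invertible_det_nz invertible_left_inverse by blast
qed

subsection \<open>Staircase systems\<close>

locale staircase = coordinate_labelling ix for ix :: "nat \<Rightarrow> 'n::finite" +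
  fixes f :: "nat \<Rightarrow> real ^ 'n \<Rightarrow> real" and a_star :: real
  assumes f_dep: "\<And>i. i \<in> {1..CARD('n)-2} \<Longrightarrow> depends_only_on_first ix (i + 2) (f i)"
    and f_smooth: "\<And>i. i \<in> {1..CARD('n)-2} \<Longrightarrow> times_cont_diff (CARD('n)) (f i)"
    and a_star: "a_star > 0"
    and f_partial:
      "\<And>i x. i \<in> {1..CARD('n)-2} \<Longrightarrow> \<bar>partial_deriv (ix (i + 2)) (f i) x\<bar> \<ge> a_star"
begin

abbreviation "a \<equiv> drift_field ix f"

lemma drift_nth:
  "i \<in> {1..CARD('n)} \<Longrightarrow> a x $ ix i = (if i \<le> CARD('n) - 2 then f i x else 0)"
  unfolding drift_field_def by (rule from_coords_nth[OF ix])

lemma staircase_field_nth: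
  "i \<in> {1..CARD('n)-2} \<Longrightarrow> staircase_field ix f g h x u $ ix i = f i x"
  unfolding staircase_field_def by (subst from_coords_nth[OF ix]) auto

text \<open>Expanding the drift along the axes gives a sum of products of an \<open>f i\<close> (or
  0) with a partial derivative of \<open>\<phi>\<close>; the latter loses one order, the former has
  order at least \<open>k\<close>.\<close>

lemma times_cont_diff_lie_deriv:
  assumes \<phi>: "times_cont_diff (Suc k) \<phi>" and k: "k \<le> CARD('n)"
  shows "times_cont_diff k (lie_deriv a \<phi>)"
proof -
  have "lie_deriv a \<phi> x = (\<Sum>i\<in>{1..CARD('n)}.
      (if i \<le> CARD('n) - 2 then f i x else 0) * frechet_derivative \<phi> (at x) (axis (ix i) 1))" for x
  proof -
    have lin: "linear (frechet_derivative \<phi> (at x))"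
      using \<phi> by (intro linear_frechet_derivative) simp
    show ?thesis
      by (simp add: lie_deriv_def drift_field_def from_coords_def linear_sum[OF lin]
          linear_scale[OF lin])
  qed
  then have "lie_deriv a \<phi> = (\<lambda>x. \<Sum>i\<in>{1..CARD('n)}.
      (if i \<le> CARD('n) - 2 then f i x else 0) * frechet_derivative \<phi> (at x) (axis (ix i) 1))"
    by blast
  moreover have "times_cont_diff k (\<lambda>x. if i \<le> CARD('n) - 2 then f i x else 0)"
    if "i \<in> {1..CARD('n)}" for i
    using that times_cont_diff_mono[OF f_smooth k, of i]
    by (cases "i \<le> CARD('n) - 2") (auto simp: times_cont_diff_const)
  ultimately show ?thesis
    using \<phi> by (auto intro!: times_cont_diff_sum times_cont_diff_mult)
qed

text \<open>The derivative of \<open>\<phi>\<close> sees only the first \<open>m\<close> components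
  of the drift. As \<open>m \<le> CARD('n) - 2\<close>, these are \<open>f 1\<close> to
  \<open>f m\<close>, which reach coordinate \<open>m + 2\<close> at most.\<close>

lemma lie_deriv_depends_only:
  assumes m: "m \<le> CARD('n) - 2" and dep: "depends_only_on_first ix m \<phi>"
    and diff: "\<And>x. \<phi> differentiable (at x)"
  shows "depends_only_on_first ix (m + 2) (lie_deriv a \<phi>)"
  unfolding depends_only_on_first_def lie_deriv_def
proof (intro allI impI)
  fix x x' :: "real ^ 'n" assume eq: "\<forall>j\<in>{1..m + 2}. x $ ix j = x' $ ix j"
  show "frechet_derivative \<phi> (at x) (a x) = frechet_derivative \<phi> (at x') (a x')"
  proof (rule frechet_derivative_depends_only[OF dep diff diff])
    fix j assume j: "j \<in> {1..m}"
    then show "x $ ix j = x' $ ix j" using eq by simp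
    have "f j x = f j x'"
      by (rule depends_only_on_firstD[OF f_dep]) (use j m eq in auto)
    then show "a x $ ix j = a x' $ ix j" using j m by (subst (1 2) drift_nth) auto
  qed
qed

text \<open>Moving along axis \<open>m + 2\<close> changes neither the derivative of
  \<open>\<phi>\<close> nor the drift components before \<open>m\<close>. So the Lie derivative is
  exactly affine in \<open>f m\<close> along this line, and no second derivative of
  \<open>\<phi>\<close> appears.\<close>

lemma partial_deriv_lie_deriv:
  assumes m: "m \<in> {1..CARD('n) - 2}" and dep: "depends_only_on_first ix m \<phi>"
    and \<phi>: "times_cont_diff 2 \<phi>"
  shows "partial_deriv (ix (m + 2)) (lie_deriv a \<phi>) x =
         partial_deriv (ix (m + 2)) (f m) x * partial_deriv (ix m) \<phi> x"
proof -
  let ?e = "axis (ix (m + 2)) 1 :: real ^ 'n"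
  have card: "m + 2 \<in> {1..CARD('n)}" using m by auto
  have diff: "\<phi> differentiable (at x)" for x using \<phi> by (simp add: numeral_2_eq_2)
  have "times_cont_diff 1 (lie_deriv a \<phi>)"
    using \<phi> m by (intro times_cont_diff_lie_deriv) (auto simp: numeral_2_eq_2)
  then have diff_lie: "lie_deriv a \<phi> differentiable (at x)" by simp
  have "times_cont_diff 1 (f m)"
    using card by (intro times_cont_diff_mono[OF f_smooth[OF m]]) simp
  then have diff_f: "f m differentiable (at x)" by simp
  have lin: "linear (frechet_derivative \<phi> (at x))" using diff by (rule linear_frechet_derivative)
  have line: "lie_deriv a \<phi> (x + s *\<^sub>R ?e) =
      lie_deriv a \<phi> x + (f m (x + s *\<^sub>R ?e) - f m x) * partial_deriv (ix m) \<phi> x" for s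
  proof -
    have "lie_deriv a \<phi> (x + s *\<^sub>R ?e) = frechet_derivative \<phi> (at x)
        (a x + (f m (x + s *\<^sub>R ?e) - f m x) *\<^sub>R axis (ix m) 1)"
      unfolding lie_deriv_def
    proof (rule frechet_derivative_depends_only[OF dep diff diff])
      fix j assume j: "j \<in> {1..m}"
      then show "(x + s *\<^sub>R ?e) $ ix j = x $ ix j"
        using m card axis_nth[of "m + 2" j] by auto
      \<comment> \<open>For \<open>j < m\<close>, \<open>f j\<close> reaches coordinate
        \<open>j + 2\<close> at most, which is below \<open>m + 2\<close>.\<close>
      have "f j (x + s *\<^sub>R ?e) = f j x" if "j \<noteq> m"
      proof (rule depends_only_on_firstD[OF f_dep])
        show "j \<in> {1..CARD('n) - 2}" using j m by auto
        show "(x + s *\<^sub>R ?e) $ ix i = x $ ix i" if "i \<in> {1..j + 2}" for i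
          using that \<open>j \<noteq> m\<close> j m card axis_nth[of "m + 2" i] by auto
      qed
      then show "a (x + s *\<^sub>R ?e) $ ix j =
          (a x + (f m (x + s *\<^sub>R ?e) - f m x) *\<^sub>R axis (ix m) 1) $ ix j"
        using j m axis_nth[of m j] by (cases "j = m") (auto simp: drift_nth)
    qed
    then show ?thesis
      by (simp add: linear_add[OF lin] linear_scale[OF lin] lie_deriv_def partial_deriv_def)
  qed
  have "((\<lambda>s. lie_deriv a \<phi> x + (f m (x + s *\<^sub>R ?e) - f m x) * partial_deriv (ix m) \<phi> x)
      has_real_derivative partial_deriv (ix (m + 2)) (f m) x * partial_deriv (ix m) \<phi> x) (at 0)"
    using frechet_derivative_line_0[OF diff_f, of ?e]
    by (auto intro!: derivative_eq_intros simp: partial_deriv_def)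
  with frechet_derivative_line_0[OF diff_lie, of ?e] show ?thesis
    unfolding line partial_deriv_def[of "ix (m + 2)" "lie_deriv a \<phi>"] by (rule DERIV_unique)
qed

section \<open>Triangular structure of the interleaved variables\<close>

definition w :: "nat \<Rightarrow> real ^ 'n \<Rightarrow> real" where
  "w m = (lie_deriv a ^^ ((m - 1) div 2)) (\<lambda>x. x $ ix (if odd m then 1 else 2))"

lemma y_var_eq: "k \<ge> 1 \<Longrightarrow> y_var ix f k = w (2 * k - 1)"
proof -
  assume "k \<ge> 1"
  then have "(2 * k - 1 - 1) div 2 = k - 1" "odd (2 * k - 1)" by auto
  then show ?thesis by (simp add: y_var_def w_def)
qed

lemma z_var_eq: "k \<ge> 1 \<Longrightarrow> z_var ix f k = w (2 * k)"
proof -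
  assume "k \<ge> 1"
  then have "(2 * k - 1) div 2 = k - 1" by auto
  then show ?thesis by (simp add: z_var_def w_def)
qed

text \<open>At \<open>m = 0\<close> truncated subtraction makes \<open>w 0\<close> and
  \<open>w 2\<close> the same coordinate function, which the hypothesis rules out.\<close>

lemma w_add_2:
  assumes "m \<ge> 1"
  shows "w (m + 2) = lie_deriv a (w m)"
proof -
  have "(m + 2 - 1) div 2 = Suc ((m - 1) div 2)" using assms by auto
  then show ?thesis by (simp add: w_def)
qed

text \<open>The claims are proved jointly, as the diagonal formula needs dependence and order 2 of
  the predecessor \<open>w (m - 2)\<close>. The order \<open>CARD('n) + 3 - m\<close> equals that of
  the \<open>f i\<close> at \<open>m = 3\<close> and stays at least 3; dropping by 2 per Lie
  derivative, it leaves room for the one order lost. Each Lie derivative contributes one factor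
  \<open>a_star\<close>.\<close>

lemma w_triangular:
  assumes "m \<in> {1..CARD('n)}"
  shows "depends_only_on_first ix m (w m) \<and> times_cont_diff (CARD('n) + 3 - m) (w m) \<and>
    (\<forall>x. \<bar>partial_deriv (ix m) (w m) x\<bar> \<ge> a_star ^ ((m - 1) div 2))"
  using assms
proof (induction m rule: less_induct)
  case (less m)
  show ?case
  proof (cases "m \<le> 2")
    case True
    then have m: "m = 1 \<or> m = 2" using less.prems by auto
    then have w: "w m = (\<lambda>x. x $ ix m)" and pow: "(m - 1) div 2 = 0" by (auto simp: w_def)
    have "frechet_derivative (w m) (at x) = (\<lambda>v. v $ ix m)" for x
      unfolding w by (rule frechet_derivative_at[symmetric])
        (rule bounded_linear_imp_has_derivative[OF bounded_linear_vec_nth])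
    then have "partial_deriv (ix m) (w m) x = 1" for x by (simp add: partial_deriv_def)
    moreover have "times_cont_diff k (w m)" for k
      unfolding w by (rule times_cont_diff_linear[OF bounded_linear_vec_nth])
    moreover have "depends_only_on_first ix m (w m)"
      using m by (auto simp: w depends_only_on_first_def)
    ultimately show ?thesis by (simp only: pow) simp
  next
    case False
    define k where "k = m - 2"
    have m: "m = k + 2" "k \<ge> 1" and k: "k \<in> {1..CARD('n) - 2}" "k \<in> {1..CARD('n)}" "k < m"
      using False less.prems by (auto simp: k_def)
    note IH = less.IH[OF k(3,2)]
    have w: "w m = lie_deriv a (w k)" using w_add_2[OF m(2)] by (simp only: m(1))
    have smooth: "times_cont_diff l (w k)" if "l \<le> CARD('n) + 3 - k" for l
      using IH that times_cont_diff_mono by blast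
    have "times_cont_diff 2 (w k)" using k by (intro smooth) auto
    then have diff: "w k differentiable (at x)" for x by (simp add: numeral_2_eq_2)
    have "depends_only_on_first ix m (w m)"
      unfolding w unfolding m(1) using k IH diff by (intro lie_deriv_depends_only) auto
    moreover have "times_cont_diff (CARD('n) + 3 - m) (w m)"
      unfolding w by (rule times_cont_diff_lie_deriv[OF smooth]) (use m k in auto)
    moreover have "\<bar>partial_deriv (ix m) (w m) x\<bar> \<ge> a_star ^ ((m - 1) div 2)" for x
    proof -
      have "(m - 1) div 2 = Suc ((k - 1) div 2)" using m by auto
      then have "a_star ^ ((m - 1) div 2) = a_star * a_star ^ ((k - 1) div 2)" by simp
      also have "\<dots> \<le> \<bar>partial_deriv (ix m) (f k) x\<bar> * \<bar>partial_deriv (ix k) (w k) x\<bar>"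
        using f_partial[OF k(1), of x] a_star IH m(1) by (intro mult_mono) auto
      also have "\<dots> = \<bar>partial_deriv (ix m) (w m) x\<bar>"
        unfolding w unfolding m(1) using k IH \<open>times_cont_diff 2 (w k)\<close>
        by (subst partial_deriv_lie_deriv) (auto simp: abs_mult)
      finally show ?thesis .
    qed
    ultimately show ?thesis by blast
  qed
qed

sublocale triangular_map ix w "\<lambda>m. a_star ^ ((m - 1) div 2)"
proof
  fix m x assume m: "m \<in> {1..CARD('n)}"
  then have "times_cont_diff 1 (w m)"
    using w_triangular[OF m] by (elim conjE times_cont_diff_mono) auto
  then show "w m differentiable (at x)" by simp
qed (use w_triangular a_star in auto)

end

text \<open>\<open>s k\<close> is the position of the \<open>k\<close>-th new variable in the interleaved order.\<close>

locale staircase_two_chains = staircase ix f a_star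
  for ix :: "nat \<Rightarrow> 'n::finite" and f a_star +
  fixes p q :: nat
  assumes card_ge: "CARD('n) \<ge> 3"
    and pq: "(CARD('n) = 2 * p \<and> q = p) \<or> (CARD('n) = 2 * p - 1 \<and> q = p - 1)"
begin

abbreviation "\<Phi> \<equiv> new_coords ix f p"

definition s :: "nat \<Rightarrow> nat" where
  "s k = (if k \<le> p then 2 * k - 1 else 2 * (k - p))"

lemma s_in: "k \<in> {1..CARD('n)} \<Longrightarrow> s k \<in> {1..CARD('n)}"
  using pq card_ge by (auto simp: s_def)

text \<open>Transfers facts about all components of \<open>\<Phi>\<close> to all \<open>w m\<close>.
  Both parities of the dimension put \<open>l + 1\<close> among the first \<open>p\<close> positions
  for odd \<open>m\<close>, and \<open>p + l\<close> among the last \<open>q\<close> for even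
  \<open>m\<close>.\<close>

lemma s_onto:
  assumes "m \<in> {1..CARD('n)}"
  obtains k where "k \<in> {1..CARD('n)}" "s k = m"
proof (cases "even m")
  case True
  then obtain l where "m = 2 * l" by blast
  then show ?thesis using that[of "p + l"] assms pq card_ge by (auto simp: s_def)
next
  case False
  then obtain l where "m = 2 * l + 1" by (blast elim: oddE)
  then show ?thesis using that[of "l + 1"] assms pq card_ge by (auto simp: s_def)
qed

lemma new_coords_nth: "k \<in> {1..CARD('n)} \<Longrightarrow> \<Phi> x $ ix k = w (s k) x"
  unfolding new_coords_def
  by (subst from_coords_nth[OF ix]) (auto simp: s_def y_var_eq z_var_eq)

section \<open>Regularity and bijectivity of the assembled map\<close>

lemma new_coords_differentiable: "\<Phi> differentiable (at x)"
proof -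
  have "(\<Sum>k\<in>{1..CARD('n)}. w (s k) x *\<^sub>R axis (ix k) 1) = \<Phi> x" for x
    unfolding new_coords_def from_coords_def
    by (rule sum.cong) (auto simp: s_def y_var_eq z_var_eq)
  then have \<Phi>: "\<Phi> = (\<lambda>x. \<Sum>k\<in>{1..CARD('n)}. w (s k) x *\<^sub>R axis (ix k) 1)" by force
  have "w (s k) differentiable (at x)" if "k \<in> {1..CARD('n)}" for k
    using s_in[OF that] by (rule diff)
  then show ?thesis unfolding \<Phi>
    by (intro differentiable_sum differentiable_scaleR differentiable_const) auto
qed

lemma frechet_derivative_new_coords_nth:
  assumes "k \<in> {1..CARD('n)}"
  shows "frechet_derivative \<Phi> (at x) v $ ix k = frechet_derivative (w (s k)) (at x) v"
proof -
  have "(\<Phi> has_derivative frechet_derivative \<Phi> (at x)) (at x)"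
    using new_coords_differentiable by (simp add: frechet_derivative_works[symmetric])
  then have "((\<lambda>x. \<Phi> x $ ix k) has_derivative (\<lambda>v. frechet_derivative \<Phi> (at x) v $ ix k)) (at x)"
    by (rule bounded_linear.has_derivative[OF bounded_linear_vec_nth])
  then have "(w (s k) has_derivative (\<lambda>v. frechet_derivative \<Phi> (at x) v $ ix k)) (at x)"
    using new_coords_nth[OF assms] by simp
  from frechet_derivative_at[OF this] show ?thesis by metis
qed

lemma new_coords_kernel:
  assumes "frechet_derivative \<Phi> (at x) v = 0"
  shows "v = 0"
proof (rule kernel_trivial)
  fix m assume "m \<in> {1..CARD('n)}"
  then obtain k where "k \<in> {1..CARD('n)}" "s k = m" by (rule s_onto)
  then show "frechet_derivative (w m) (at x) v = 0"
    using frechet_derivative_new_coords_nth[of k x v] assms by simp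
qed

lemma new_coords_bij: "bij \<Phi>"
proof (rule bijI)
  show "inj \<Phi>"
  proof (rule injI)
    fix x x' assume eq: "\<Phi> x = \<Phi> x'"
    show "x = x'"
    proof (rule components_eq_imp_eq)
      fix m assume "m \<in> {1..CARD('n)}"
      then obtain k where "k \<in> {1..CARD('n)}" "s k = m" by (rule s_onto)
      then show "w m x = w m x'" using new_coords_nth[of k] eq by metis
    qed
  qed
  show "surj \<Phi>"
    unfolding surj_def
  proof
    fix y :: "real ^ 'n"
    \<comment> \<open>The prescribed values in interleaved order: the index is the inverse of
      \<open>s\<close> at \<open>m\<close>.\<close>
    define r where "r m = y $ ix (if odd m then (m + 1) div 2 else p + m div 2)" for m
    obtain x where x: "\<And>m. m \<in> {1..CARD('n)} \<Longrightarrow> w m x = r m"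
      using components_surj[of r] by blast
    have "\<Phi> x = y"
    proof (rule vec_eqI)
      fix k assume k: "k \<in> {1..CARD('n)}"
      have "r (s k) = y $ ix k"
      proof (cases "k \<le> p")
        case True
        with k have "odd (2 * k - 1)" "(2 * k - 1 + 1) div 2 = k" by auto
        then show ?thesis using True by (simp add: r_def s_def)
      qed (auto simp: r_def s_def)
      then show "\<Phi> x $ ix k = y $ ix k" using new_coords_nth[OF k] x[OF s_in[OF k]] by simp
    qed
    then show "\<exists>x. y = \<Phi> x" by blast
  qed
qed

text \<open>Away from the chain ends \<open>p\<close> and \<open>p + q\<close>, \<open>s k\<close>
  is at most \<open>CARD('n) - 2\<close>. The derivative of \<open>w (s k)\<close> then sees only
  components where the staircase field equals the drift, so the control drops out and a Lie
  derivative remains.\<close>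

lemma chain_step:
  assumes k: "k \<in> {1..CARD('n)}" "k \<noteq> p" "k \<noteq> p + q"
  shows "frechet_derivative \<Phi> (at x) (staircase_field ix f g h x u) $ ix k = \<Phi> x $ ix (k + 1)"
proof -
  have sk: "s k \<in> {1..CARD('n) - 2}" "s (k + 1) = s k + 2" and k1: "k + 1 \<in> {1..CARD('n)}"
    using k pq card_ge by (auto simp: s_def)
  then have sk': "s k \<in> {1..CARD('n)}" by auto
  have "frechet_derivative (w (s k)) (at x) (staircase_field ix f g h x u) =
      frechet_derivative (w (s k)) (at x) (a x)"
  proof (rule frechet_derivative_depends_only[OF dep[OF sk'] diff[OF sk'] diff[OF sk'] refl])
    fix j assume "j \<in> {1..s k}"
    then have "j \<in> {1..CARD('n) - 2}" "j \<in> {1..CARD('n)}" using sk by auto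
    then show "staircase_field ix f g h x u $ ix j = a x $ ix j"
      using staircase_field_nth[of j] drift_nth[of j] by simp
  qed
  also have "\<dots> = w (s (k + 1)) x" using sk w_add_2[of "s k"] by (simp add: lie_deriv_def)
  finally show ?thesis
    using frechet_derivative_new_coords_nth[OF k(1)] new_coords_nth[OF k1] by simp
qed

lemma new_coords_maps_system:
  "\<exists>H1 H2. maps_system \<Phi> (staircase_field ix f g h) (two_chain_field ix p q H1 H2)"
proof -
  \<comment> \<open>The last equation of each chain is the transformed field itself, expressed in
    the new variables through \<open>inv \<Phi>\<close>.\<close>
  define H where "H i y u =
    frechet_derivative \<Phi> (at (inv \<Phi> y)) (staircase_field ix f g h (inv \<Phi> y) u) $ ix i" for i y u
  have "maps_system \<Phi> (staircase_field ix f g h) (two_chain_field ix p q (H p) (H (p + q)))"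
  proof (rule maps_system_pushforward[OF new_coords_differentiable new_coords_kernel new_coords_bij])
    fix x u
    show "frechet_derivative \<Phi> (at x) (staircase_field ix f g h x u) =
        two_chain_field ix p q (H p) (H (p + q)) (\<Phi> x) u"
    proof (rule vec_eqI)
      fix k assume k: "k \<in> {1..CARD('n)}"
      have "inv \<Phi> (\<Phi> x) = x" using new_coords_bij by (simp add: bij_is_inj)
      then show "frechet_derivative \<Phi> (at x) (staircase_field ix f g h x u) $ ix k =
          two_chain_field ix p q (H p) (H (p + q)) (\<Phi> x) u $ ix k"
        using chain_step[OF k] by (simp add: two_chain_field_def from_coords_nth[OF ix k] H_def)
    qed
  qed
  then show ?thesis by blast
qed

end

theorem mainTheorem5:
  fixes ix :: "nat \<Rightarrow> 'n::finite"
    and n p q :: nat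
    and f :: "nat \<Rightarrow> real ^ 'n \<Rightarrow> real"
    and g h :: "real ^ 'n \<Rightarrow> real \<Rightarrow> real"
    and a_star :: real
  assumes n: "n = CARD('n)" "n \<ge> 3"
    and ix: "bij_betw ix {1..n} UNIV"
    and f_dep: "\<And>i. i \<in> {1..n-2} \<Longrightarrow> depends_only_on_first ix (i + 2) (f i)"
    and f_smooth: "\<And>i. i \<in> {1..n-2} \<Longrightarrow> times_cont_diff n (f i)"
    and g_smooth: "times_cont_diff 1 (\<lambda>(x, u). g x u)"
    and h_smooth: "times_cont_diff 1 (\<lambda>(x, u). h x u)"
    and a_star: "a_star > 0"
    and f_partial:
      "\<And>i x. i \<in> {1..n-2} \<Longrightarrow> \<bar>partial_deriv (ix (i + 2)) (f i) x\<bar> \<ge> a_star"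
    and pq: "(n = 2 * p \<and> q = p) \<or> (n = 2 * p - 1 \<and> q = p - 1)"
  shows "(\<forall>k\<in>{1..p}. depends_only_on_first ix (2 * k - 1) (y_var ix f k)) \<and>
         (\<forall>k\<in>{1..q}. depends_only_on_first ix (2 * k) (z_var ix f k)) \<and>
         (\<forall>x. new_coords ix f p differentiable (at x) \<and>
              det (jacobian (new_coords ix f p) (at x)) \<noteq> 0) \<and>
         (\<forall>w. \<exists>!x. new_coords ix f p x = w) \<and>
         (\<exists>H1 H2. maps_system (new_coords ix f p)
                    (staircase_field ix f g h) (two_chain_field ix p q H1 H2))"
proof -
  interpret staircase_two_chains ix f a_star p q
    using assms by unfold_locales auto
  \<comment> \<open>In both parities \<open>2 * p - 1 \<le> n\<close> and
    \<open>2 * q \<le> n\<close>, so these positions are valid indices of \<open>w\<close>.\<close>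
  have "depends_only_on_first ix (2 * k - 1) (y_var ix f k)" if "k \<in> {1..p}" for k
    using that pq n(1) y_var_eq[of k] by (auto intro!: dep)
  moreover have "depends_only_on_first ix (2 * k) (z_var ix f k)" if "k \<in> {1..q}" for k
    using that pq n(1) z_var_eq[of k] by (auto intro!: dep)
  moreover have "det (jacobian (new_coords ix f p) (at x)) \<noteq> 0" for x
    using new_coords_differentiable new_coords_kernel by (rule det_jacobian_nonzero)
  moreover have "\<exists>!x. new_coords ix f p x = w" for w
    using new_coords_bij by (simp add: bij_iff)
  ultimately show ?thesis
    using new_coords_differentiable new_coords_maps_system by blast
qed

end
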